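(* Consider SPARKLE-ED (that is, $A_s=W_s$, $B_s=(I-W_s)^{1/2}$, $C_s=W_s$ for all $s\in\{x,y,z\}$) or SPARKLE-EXTRA ($A_s=I$, $B_s=(I-W_s)^{1/2}$, $C_s=W_s$ for all $s$), with $W_y=W_z$. Then (for a suitable choice of the factorizations defining $\mathbf O_s,\mathbf\Gamma_s$) $$\delta_x=\mathcal O\big((1-\rho(W_x))^{-2}\big),\qquad \delta_y=\delta_z=\mathcal O\big((1-\rho(W_y))^{-2}\big),$$ $$\hat\delta_x=\mathcal O\big((1-\rho(W_x))^{-3/2}\big),\qquad \hat\delta_y=\hat\delta_z=\mathcal O\big((1-\rho(W_y))^{-2}\big).$$ Furthermore, if $W_x=W_y=W_z$ and $\rho=\rho(W_x)$, then the transient iteration complexity $\max\{n^2\delta_x,n^3\delta_y,n^3\delta_z,n\hat\delta_x,n\hat\delta_y,n\hat\delta_z\}$ of the algorithm simplifies to order $n^3/(1-\rho)^2$.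
   Context: **Problem.** Agents $i=1,\dots,n$ hold $f_i(x,y)=\mathbb E_{\phi\sim\mathcal D_{f_i}}[F_i(x,y;\phi)]$ and $g_i(x,y)=\mathbb E_{\xi\sim\mathcal D_{g_i}}[G_i(x,y;\xi)]$ on $\mathbb R^p\times\mathbb R^q$. Put $f=\frac1n\sum_if_i$, $g=\frac1n\sum_ig_i$, $y^\star(x)=\arg\min_yg(x,y)$, $\Phi(x)=f(x,y^\star(x))$; indices $1,2$ on $\nabla$ denote derivatives in the first/second argument. $\|\cdot\|$ is the Euclidean/spectral norm. **Assumptions.** (1) For every $i$: $\nabla f_i,\nabla g_i,\nabla^2g_i$ are Lipschitz with constants $L_{f,1},L_{g,1},L_{g,2}$; $\|\nabla_2f_i(x,y^\star(x))\|\le L_{f,0}$ for all $x$; $g_i(x,\cdot)$ is $\mu_g$-strongly convex for every $x$. (2) For $s\in\{x,y,z\}$, $W_s\in\mathbb R^{n\times n}$ is nonnegative, symmetric, doubly stochastic, with eigenvalues $1=\lambda_1>\lambda_2\ge\dots\ge\lambda_n$ and $\rho(W_s)=\max\{|\lambda_2|,|\lambda_n|\}<1$; moreover $W_s$ is positive definite with smallest eigenvalue bounded below by a positive constant $\underline\rho$, treated as an absolute constant (otherwise $W_s$ is replaced by $tI+(1-t)W_s$ for a constant $t\in(0,1)$). (3) The stochastic estimates $\nabla F_i,\nabla G_i,\nabla^2G_i$ are unbiased for $\nabla f_i,\nabla g_i,\nabla^2g_i$ with variances bounded by $\sigma_{f,1}^2,\sigma_{g,1}^2,\sigma_{g,2}^2$.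 **SPARKLE algorithm.** Bold letters stack agents: $\mathbf x^k=\mathrm{col}\{x_1^k,\dots,x_n^k\}$, and $\mathbf A_s=A_s\otimes I$, $\mathbf B_s=B_s\otimes I$, $\mathbf C_s=C_s\otimes I$; $\bar x^k=\frac1n\sum_ix_i^k$. Start from $\mathbf x^0=\mathbf y^0=\mathbf z^0=\mathbf r^0=\mathbf 0$, $\mathbf d_x^0=\mathbf d_y^0=\mathbf d_z^0=\mathbf 0$; for $k=0,1,\dots$ $\mathbf y^{k+1}=\mathbf C_y\mathbf y^k-\beta\mathbf A_y\mathbf v^k-\mathbf B_y\mathbf d_y^k$, $\mathbf d_y^{k+1}=\mathbf d_y^k+\mathbf B_y\mathbf y^{k+1}$; $\mathbf z^{k+1}=\mathbf C_z\mathbf z^k-\gamma\mathbf A_z\mathbf p^k-\mathbf B_z\mathbf d_z^k$, $\mathbf d_z^{k+1}=\mathbf d_z^k+\mathbf B_z\mathbf z^{k+1}$; $\mathbf r^{k+1}=(1-\theta)\mathbf r^k+\theta\mathbf u^k$; $\mathbf x^{k+1}=\mathbf C_x\mathbf x^k-\alpha\mathbf A_x\mathbf r^{k+1}-\mathbf B_x\mathbf d_x^k$, $\mathbf d_x^{k+1}=\mathbf d_x^k+\mathbf B_x\mathbf x^{k+1}$. Here $v_i^k=\nabla_2G_i(x_i^k,y_i^k;\cdot)$; $p_i^k=H_i^kz_i^k-b_i^k$ with $H_i^k=\nabla^2_{22}G_i(x_i^k,y_i^{k+1};\cdot)$, $b_i^k=\nabla_2F_i(x_i^k,y_i^{k+1};\cdot)$;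 $u_i^k=l_i^k-J_i^kz_i^{k+1}$ with $l_i^k=\nabla_1F_i(x_i^k,y_i^{k+1};\cdot)$, $J_i^k=\nabla^2_{12}G_i(x_i^k,y_i^{k+1};\cdot)$. The samples are independent across agents and, conditionally on the history available before each of $\mathbf v^k,\mathbf p^k,\mathbf u^k$ is formed, the estimates are unbiased with variances bounded by $\sigma_{f,1}^2$ (for $\nabla F_i$), $\sigma_{g,1}^2$ (for $\nabla G_i$) and $\sigma_{g,2}^2$ (for $\nabla^2G_i$). **Matrix quantities.** Write $W_s=U_s\,\mathrm{diag}(1,\Lambda_s)U_s^\top$, $U_s=[\frac1{\sqrt n}\mathbf 1_n,\hat U_s]$ orthogonal. Then $A_s=U_s\mathrm{diag}(1,\Lambda_{sa})U_s^\top$, $B_s^2=U_s\mathrm{diag}(0,\Lambda_{sb}^2)U_s^\top$, $C_s=U_s\mathrm{diag}(1,\Lambda_{sc})U_s^\top$ with diagonal $\Lambda_{sa},\Lambda_{sb},\Lambda_{sc}$ of size $n-1$ and $\Lambda_{sb}$ positive definite; bold versions are $\otimes I$. Factor $\mathbf M_s=\begin{bmatrix}\mathbf\Lambda_{sc}-\mathbf\Lambda_{sb}^2&-\mathbf\Lambda_{sb}\\\mathbf\Lambda_{sb}&\mathbf I\end{bmatrix}=\mathbf O_s\mathbf\Gamma_s\mathbf O_s^{-1}$ with $\mathbf O_s$ invertible and $\|\mathbf\Gamma_s\|<1$ (same factorization for equal data). For $s\in\{y,z\}$, $$\delta_s=\Big(\tfrac{\|\mathbf O_s\|^2\|\mathbf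 O_s^{-1}\|^2}{1-\|\mathbf\Gamma_s\|}\Big)^2\|\mathbf\Lambda_{sa}\|^2,\quad \hat\delta_s=\Big(\tfrac{\|\mathbf O_s\|\|\mathbf O_s^{-1}\|\|\mathbf\Lambda_{sb}^{-1}\|}{1-\|\mathbf\Gamma_s\|}\Big)^{4/3},$$ $$\delta_x=\Big(\tfrac{\|\mathbf O_x\|\|\mathbf O_x^{-1}\|}{1-\|\mathbf\Gamma_x\|}\|\mathbf\Lambda_{xa}\|\Big)^2,\quad \hat\delta_x=\Big(\tfrac{\|\mathbf O_x\|^2\|\mathbf O_x^{-1}\|^2\|\mathbf\Lambda_{xb}^{-1}\|^2}{1-\|\mathbf\Gamma_x\|}\Big)^{2/3}+\tfrac{\|\mathbf O_x\|\|\mathbf O_x^{-1}\|\|\mathbf\Lambda_{xb}^{-1}\|}{1-\|\mathbf\Gamma_x\|}.$$ **Transient iteration complexity.** The number of iterations $K$ (up to constants) after which, for suitable constant $\alpha,\beta,\gamma,\theta$, the guaranteed bound on $\frac1{K+1}\sum_{k\le K}\mathbb E\|\nabla\Phi(\bar x^k)\|^2$ is of the linear-speedup order $1/\sqrt{nK}$; dependence on the initialization, smoothness constants, $\kappa=\max\{L_{f,0},L_{f,1},L_{g,1},L_{g,2}\}/\mu_g$ and noise levels is suppressed. For SPARKLE it is of order $\max\{n^2\delta_x,n^3\delta_y,n^3\delta_z,n\hat\delta_x,n\hat\delta_y,n\hat\delta_z\}$. *)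

theory Defs
  imports
    Complex_Main
    "HOL-Library.Multiset"
    "HOL-Computational_Algebra.Polynomial"
    "Jordan_Normal_Form.Matrix"
    "Jordan_Normal_Form.Gauss_Jordan_Elimination"
    "Jordan_Normal_Form.Char_Poly"
begin

text \<open>
  The constants in the order statements have to be uniform in the number of agents \<open>n\<close> and the
  dimensions \<open>p\<close>, \<open>q\<close>, so matrices are carrier-indexed rather than type-indexed.
\<close>

definition vec_norm2 :: "real vec \<Rightarrow> real" where
  "vec_norm2 v = sqrt (v \<bullet> v)"

definition spec_norm :: "real mat \<Rightarrow> real" where
  "spec_norm A = Sup {vec_norm2 (A *\<^sub>v v) | v. v \<in> carrier_vec (dim_col A) \<and> vec_norm2 v = 1}"

text \<open>Only meaningful for invertible arguments.\<close>
definition minv :: "real mat \<Rightarrow> real mat" where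
  "minv A = the (mat_inverse A)"

definition kron :: "real mat \<Rightarrow> real mat \<Rightarrow> real mat" where
  "kron A B = mat (dim_row A * dim_row B) (dim_col A * dim_col B)
     (\<lambda>(i, j). A $$ (i div dim_row B, j div dim_col B) * B $$ (i mod dim_row B, j mod dim_col B))"

definition symmetric_mat :: "real mat \<Rightarrow> bool" where
  "symmetric_mat A \<longleftrightarrow> square_mat A \<and> transpose_mat A = A"

definition pos_semidef :: "real mat \<Rightarrow> bool" where
  "pos_semidef A \<longleftrightarrow> symmetric_mat A \<and> (\<forall>v \<in> carrier_vec (dim_row A). v \<bullet> (A *\<^sub>v v) \<ge> 0)"

definition pos_def :: "real mat \<Rightarrow> bool" where
  "pos_def A \<longleftrightarrow> symmetric_mat A \<and>
     (\<forall>v \<in> carrier_vec (dim_row A). v \<noteq> 0\<^sub>v (dim_row A) \<longrightarrow> v \<bullet> (A *\<^sub>v v) > 0)"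

text \<open>\<open>B = M\<^sup>1\<^sup>/\<^sup>2\<close>, the (unique) positive semidefinite square root.\<close>
definition is_sqrt_mat :: "real mat \<Rightarrow> real mat \<Rightarrow> bool" where
  "is_sqrt_mat M B \<longleftrightarrow> pos_semidef B \<and> dim_row B = dim_row M \<and> B * B = M"

text \<open>
  The real eigenvalues with algebraic multiplicity in descending order; the informal
  \<open>\<lambda>\<^sub>i\<close> is \<open>eigs W ! (i - 1)\<close>. For symmetric matrices this list has length \<open>dim_row W\<close>.
\<close>
definition eigs :: "real mat \<Rightarrow> real list" where
  "eigs W = rev (sorted_list_of_multiset (proots (char_poly W)))"

definition mix_rate :: "real mat \<Rightarrow> real" where
  "mix_rate W = max \<bar>eigs W ! 1\<bar> \<bar>eigs W ! (dim_row W - 1)\<bar>"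

definition mixing_matrix :: "nat \<Rightarrow> real \<Rightarrow> real mat \<Rightarrow> bool" where
  "mixing_matrix n \<rho>0 W \<longleftrightarrow>
     W \<in> carrier_mat n n \<and>
     (\<forall>i<n. \<forall>j<n. W $$ (i, j) \<ge> 0) \<and>
     symmetric_mat W \<and>
     (\<forall>i<n. (\<Sum>j<n. W $$ (i, j)) = 1) \<and>
     (\<forall>j<n. (\<Sum>i<n. W $$ (i, j)) = 1) \<and>
     eigs W ! 0 = 1 \<and> eigs W ! 1 < 1 \<and>
     mix_rate W < 1 \<and>
     pos_def W \<and> \<rho>0 \<le> eigs W ! (n - 1)"

datatype variant = ED | EXTRA

fun sparkle_matrices :: "variant \<Rightarrow> real mat \<Rightarrow> real mat \<Rightarrow> real mat \<Rightarrow> real mat \<Rightarrow> bool" where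
  "sparkle_matrices ED W A B C \<longleftrightarrow>
     A = W \<and> is_sqrt_mat (1\<^sub>m (dim_row W) - W) B \<and> C = W"
| "sparkle_matrices EXTRA W A B C \<longleftrightarrow>
     A = 1\<^sub>m (dim_row W) \<and> is_sqrt_mat (1\<^sub>m (dim_row W) - W) B \<and> C = W"

definition sub_eigs_mat :: "real mat \<Rightarrow> real mat" where
  "sub_eigs_mat W = mat_diag (dim_row W - 1) (\<lambda>i. eigs W ! (i + 1))"

text \<open>
  \<open>U\<close> is orthogonal with first column \<open>1/\<surd>n\<close> and diagonalises \<open>W\<close>, \<open>A\<close>, \<open>B\<^sup>2\<close>, \<open>C\<close> simultaneously;
  \<open>La\<close>, \<open>Lb\<close>, \<open>Lc\<close> are the diagonal blocks of size \<open>n - 1\<close>.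
\<close>
definition spectral_data ::
  "nat \<Rightarrow> real mat \<Rightarrow> real mat \<Rightarrow> real mat \<Rightarrow> real mat \<Rightarrow>
   real mat \<Rightarrow> real mat \<Rightarrow> real mat \<Rightarrow> real mat \<Rightarrow> bool" where
  "spectral_data n W A B C U La Lb Lc \<longleftrightarrow>
     U \<in> carrier_mat n n \<and> U * transpose_mat U = 1\<^sub>m n \<and> transpose_mat U * U = 1\<^sub>m n \<and>
     (\<forall>i<n. U $$ (i, 0) = 1 / sqrt (real n)) \<and>
     La \<in> carrier_mat (n - 1) (n - 1) \<and> diagonal_mat La \<and>
     Lb \<in> carrier_mat (n - 1) (n - 1) \<and> diagonal_mat Lb \<and> pos_def Lb \<and>
     Lc \<in> carrier_mat (n - 1) (n - 1) \<and> diagonal_mat Lc \<and>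
     W = U * diag_block_mat [1\<^sub>m 1, sub_eigs_mat W] * transpose_mat U \<and>
     A = U * diag_block_mat [1\<^sub>m 1, La] * transpose_mat U \<and>
     B * B = U * diag_block_mat [0\<^sub>m 1 1, Lb * Lb] * transpose_mat U \<and>
     C = U * diag_block_mat [1\<^sub>m 1, Lc] * transpose_mat U"

definition bold :: "nat \<Rightarrow> real mat \<Rightarrow> real mat" where
  "bold d A = kron A (1\<^sub>m d)"

text \<open>The arguments of \<open>M_mat\<close> and of the \<open>delta\<close> functions below are the bold matrices.\<close>
definition M_mat :: "real mat \<Rightarrow> real mat \<Rightarrow> real mat" where
  "M_mat Lb Lc = four_block_mat (Lc - Lb * Lb) (- Lb) Lb (1\<^sub>m (dim_row Lb))"

definition factorization :: "real mat \<Rightarrow> real mat \<Rightarrow> real mat \<Rightarrow> bool" where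
  "factorization M Q G \<longleftrightarrow>
     Q \<in> carrier_mat (dim_row M) (dim_row M) \<and> G \<in> carrier_mat (dim_row M) (dim_row M) \<and>
     invertible_mat Q \<and> M = Q * G * minv Q \<and> spec_norm G < 1"

definition delta_yz :: "real mat \<Rightarrow> real mat \<Rightarrow> real mat \<Rightarrow> real" where
  "delta_yz Q G La =
     ((spec_norm Q)\<^sup>2 * (spec_norm (minv Q))\<^sup>2 / (1 - spec_norm G))\<^sup>2 * (spec_norm La)\<^sup>2"

definition delta_hat_yz :: "real mat \<Rightarrow> real mat \<Rightarrow> real mat \<Rightarrow> real" where
  "delta_hat_yz Q G Lb =
     (spec_norm Q * spec_norm (minv Q) * spec_norm (minv Lb) / (1 - spec_norm G)) powr (4 / 3)"

definition delta_x :: "real mat \<Rightarrow> real mat \<Rightarrow> real mat \<Rightarrow> real" where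
  "delta_x Q G La =
     (spec_norm Q * spec_norm (minv Q) / (1 - spec_norm G) * spec_norm La)\<^sup>2"

definition delta_hat_x :: "real mat \<Rightarrow> real mat \<Rightarrow> real mat \<Rightarrow> real" where
  "delta_hat_x Q G Lb =
     ((spec_norm Q)\<^sup>2 * (spec_norm (minv Q))\<^sup>2 * (spec_norm (minv Lb))\<^sup>2 / (1 - spec_norm G))
        powr (2 / 3)
     + spec_norm Q * spec_norm (minv Q) * spec_norm (minv Lb) / (1 - spec_norm G)"

definition transient_complexity ::
  "nat \<Rightarrow> real \<Rightarrow> real \<Rightarrow> real \<Rightarrow> real \<Rightarrow> real \<Rightarrow> real \<Rightarrow> real" where
  "transient_complexity n dx dy dz hx hy hz =
     Max {real n ^ 2 * dx, real n ^ 3 * dy, real n ^ 3 * dz, real n * hx, real n * hy, real n * hz}"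

text \<open>The index \<open>s \<in> {x, y, z}\<close>: \<open>x\<close> lives in dimension \<open>p\<close>, both \<open>y\<close> and \<open>z\<close> in dimension \<open>q\<close>.\<close>
datatype block = BX | BY | BZ

fun block_dim :: "nat \<Rightarrow> nat \<Rightarrow> block \<Rightarrow> nat" where
  "block_dim p q BX = p"
| "block_dim p q BY = q"
| "block_dim p q BZ = q"

end

theory Submission
  imports Defs
begin

text \<open>
  All blocks of \<open>M\<close> are diagonal, so \<open>M\<close> is a direct sum of \<open>2 \<times> 2\<close> matrices, one for each
  eigenvalue \<open>\<lambda>\<close> of \<open>W\<close> other than the leading \<open>1\<close>. Each of them is conjugate to \<open>\<surd>\<lambda>\<close> times a
  rotation by a matrix whose condition number is controlled by the lower bound \<open>\<rho>0 \<le> \<lambda>\<close> alone.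
  Hence \<open>\<parallel>\<Gamma>\<parallel> = \<surd>\<rho>\<close> exactly, where \<open>\<rho>\<close> is the mixing rate, and \<open>1 - \<surd>\<rho>\<close> lies between \<open>(1 - \<rho>) / 2\<close>
  and \<open>1 - \<rho>\<close>; the lower estimate gives the upper bounds, the upper estimate the lower bound on the
  complexity through the term \<open>n\<^sup>3 \<delta>\<^sub>y\<close>.
\<close>

section \<open>Euclidean and spectral norms\<close>

lemma vec_norm2_nonneg: "vec_norm2 v \<ge> 0"
  by (simp add: vec_norm2_def scalar_prod_def sum_nonneg)

lemma vec_norm2_sq: "(vec_norm2 v)\<^sup>2 = (\<Sum>i<dim_vec v. (v $ i)\<^sup>2)"
  by (simp add: vec_norm2_def scalar_prod_def sum_nonneg power2_eq_square atLeast0LessThan)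

lemma vec_norm2_unit_vec: "i < n \<Longrightarrow> vec_norm2 (unit_vec n i) = 1"
  by (simp add: vec_norm2_def)

text \<open>The supremum of an empty set of reals has no useful value, so a positive number of
  columns is required to supply a unit vector. Comparing squares keeps the later estimates
  polynomial.\<close>

lemma spec_norm_le:
  assumes "dim_col A > 0" "c \<ge> 0"
    and "\<And>v. v \<in> carrier_vec (dim_col A) \<Longrightarrow> (vec_norm2 (A *\<^sub>v v))\<^sup>2 \<le> c\<^sup>2 * (vec_norm2 v)\<^sup>2"
  shows "spec_norm A \<le> c"
  unfolding spec_norm_def
proof (rule cSup_least)
  show "{vec_norm2 (A *\<^sub>v v) |v. v \<in> carrier_vec (dim_col A) \<and> vec_norm2 v = 1} \<noteq> {}"
    using assms(1) vec_norm2_unit_vec[of 0 "dim_col A"] unit_vec_carrier[of "dim_col A" 0] by blast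
next
  fix x assume "x \<in> {vec_norm2 (A *\<^sub>v v) |v. v \<in> carrier_vec (dim_col A) \<and> vec_norm2 v = 1}"
  then obtain v where "v \<in> carrier_vec (dim_col A)" "vec_norm2 v = 1" "x = vec_norm2 (A *\<^sub>v v)"
    by auto
  with assms(3)[of v] have "x\<^sup>2 \<le> c\<^sup>2" by simp
  then show "x \<le> c" using assms(2) by (rule power2_le_imp_le)
qed

text \<open>A test vector bounds a supremum from below only if the set is bounded above;
  \<open>c\<close> guarantees this and may be arbitrarily crude.\<close>

lemma spec_norm_ge:
  assumes "c \<ge> 0"
    and "\<And>v. v \<in> carrier_vec (dim_col A) \<Longrightarrow> (vec_norm2 (A *\<^sub>v v))\<^sup>2 \<le> c\<^sup>2 * (vec_norm2 v)\<^sup>2"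
    and "w \<in> carrier_vec (dim_col A)" "vec_norm2 w = 1" "b\<^sup>2 \<le> (vec_norm2 (A *\<^sub>v w))\<^sup>2"
  shows "b \<le> spec_norm A"
proof -
  have "b \<le> vec_norm2 (A *\<^sub>v w)"
    using assms(5) vec_norm2_nonneg power2_le_imp_le by blast
  also have "\<dots> \<le> spec_norm A"
    unfolding spec_norm_def
  proof (rule cSup_upper)
    show "bdd_above {vec_norm2 (A *\<^sub>v v) |v. v \<in> carrier_vec (dim_col A) \<and> vec_norm2 v = 1}"
    proof (rule bdd_aboveI)
      fix x assume "x \<in> {vec_norm2 (A *\<^sub>v v) |v. v \<in> carrier_vec (dim_col A) \<and> vec_norm2 v = 1}"
      then obtain v where "v \<in> carrier_vec (dim_col A)" "vec_norm2 v = 1" "x = vec_norm2 (A *\<^sub>v v)"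
        by auto
      with assms(2)[of v] have "x\<^sup>2 \<le> c\<^sup>2" by simp
      then show "x \<le> c" using assms(1) by (rule power2_le_imp_le)
    qed
  qed (use assms in auto)
  finally show ?thesis .
qed

section \<open>Inverses and diagonal matrices\<close>

lemma minv_eqI:
  assumes "A \<in> carrier_mat n n" "B \<in> carrier_mat n n" "A * B = 1\<^sub>m n" "B * A = 1\<^sub>m n"
  shows "minv A = B"
proof (cases "mat_inverse A")
  \<comment> \<open>\<open>None\<close> means that \<open>A\<close> is no unit of the matrix ring,
    which the two-sided inverse \<open>B\<close> refutes.\<close>
  case None
  then have "A \<notin> Units (ring_mat TYPE(real) n ())"
    by (rule mat_inverse(1)[OF assms(1)])
  then show ?thesis
    using assms by (auto simp: Units_def ring_mat_def)
next
  case (Some C)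
  then have C: "A * C = 1\<^sub>m n" "C \<in> carrier_mat n n"
    using mat_inverse(2)[OF assms(1)] by auto
  have "C = (B * A) * C" using C assms(4) by simp
  also have "\<dots> = B * (A * C)" using assms(1,2) C(2) by (intro assoc_mult_mat)
  also have "\<dots> = B" using C(1) assms(2) by simp
  finally show ?thesis using Some by (simp add: minv_def)
qed

lemma mat_diag_index [simp]:
  "i < n \<Longrightarrow> j < n \<Longrightarrow> mat_diag n f $$ (i, j) = (if i = j then f j else 0)"
  "dim_row (mat_diag n f) = n" "dim_col (mat_diag n f) = n"
  by (auto simp: mat_diag_def)

lemma mat_diag_eq_iff: "mat_diag n f = mat_diag n g \<longleftrightarrow> (\<forall>i<n. f i = g i)"
proof
  assume *: "mat_diag n f = mat_diag n g"
  show "\<forall>i<n. f i = g i"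
  proof (intro allI impI)
    fix i assume "i < n"
    then show "f i = g i"
      using arg_cong[OF *, of "\<lambda>A. A $$ (i, i)"] by simp
  qed
qed (auto intro!: eq_matI)

lemma mat_diag_arith:
  fixes f g :: "nat \<Rightarrow> real"
  shows "mat_diag n f + mat_diag n g = mat_diag n (\<lambda>i. f i + g i)"
    "mat_diag n f - mat_diag n g = mat_diag n (\<lambda>i. f i - g i)"
    "- mat_diag n f = mat_diag n (\<lambda>i. - f i)"
  by (auto intro!: eq_matI)

lemma mat_diag_mult_vec:
  fixes f :: "nat \<Rightarrow> real"
  assumes "v \<in> carrier_vec n"
  shows "mat_diag n f *\<^sub>v v = vec n (\<lambda>i. f i * v $ i)"
proof (rule eq_vecI)
  fix i assume "i < dim_vec (vec n (\<lambda>i. f i * v $ i))"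
  then have i: "i < n" by simp
  have "(mat_diag n f *\<^sub>v v) $ i = (\<Sum>j<n. (if i = j then f j else 0) * v $ j)"
    using i assms by (auto simp: scalar_prod_def atLeast0LessThan intro!: sum.cong)
  also have "\<dots> = (\<Sum>j<n. if j = i then f i * v $ i else 0)"
    by (rule sum.cong) auto
  finally show "(mat_diag n f *\<^sub>v v) $ i = vec n (\<lambda>i. f i * v $ i) $ i"
    using i by simp
qed simp

lemma vec_norm2_mat_diag:
  assumes "v \<in> carrier_vec n"
  shows "(vec_norm2 (mat_diag n f *\<^sub>v v))\<^sup>2 = (\<Sum>i<n. (f i)\<^sup>2 * (v $ i)\<^sup>2)"
  unfolding mat_diag_mult_vec[OF assms] vec_norm2_sq by (simp add: power_mult_distrib)

lemma vec_norm2_mat_diag_le: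
  assumes "\<And>i. i < n \<Longrightarrow> \<bar>f i\<bar> \<le> c" "v \<in> carrier_vec n"
  shows "(vec_norm2 (mat_diag n f *\<^sub>v v))\<^sup>2 \<le> c\<^sup>2 * (vec_norm2 v)\<^sup>2"
proof -
  have "(\<Sum>i<n. (f i)\<^sup>2 * (v $ i)\<^sup>2) \<le> (\<Sum>i<n. c\<^sup>2 * (v $ i)\<^sup>2)"
    using assms(1) by (intro sum_mono mult_right_mono power2_mono) (auto intro: order_trans[OF _ abs_ge_self])
  then show ?thesis
    using assms(2) by (simp only: vec_norm2_mat_diag[OF assms(2)])
      (simp add: vec_norm2_sq sum_distrib_left)
qed

lemma spec_norm_mat_diag_le:
  assumes "n > 0" "\<And>i. i < n \<Longrightarrow> \<bar>f i\<bar> \<le> c"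
  shows "spec_norm (mat_diag n f) \<le> c"
proof -
  have "c \<ge> 0" using assms(2)[OF assms(1)] by linarith
  then show ?thesis
    using assms vec_norm2_mat_diag_le[of n f c] by (intro spec_norm_le) auto
qed

lemma spec_norm_mat_diag_ge:
  assumes "i < n"
  shows "\<bar>f i\<bar> \<le> spec_norm (mat_diag n f)"
proof (rule spec_norm_ge)
  show "(vec_norm2 (mat_diag n f *\<^sub>v v))\<^sup>2 \<le> (\<Sum>i<n. \<bar>f i\<bar>)\<^sup>2 * (vec_norm2 v)\<^sup>2"
    if "v \<in> carrier_vec (dim_col (mat_diag n f))" for v
    using that by (intro vec_norm2_mat_diag_le member_le_sum) auto
  show "vec_norm2 (unit_vec n i) = 1" by (rule vec_norm2_unit_vec[OF assms])
  have "(\<Sum>j<n. (f j)\<^sup>2 * (unit_vec n i $ j)\<^sup>2) = (\<Sum>j<n. if j = i then (f i)\<^sup>2 else 0)"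
    using assms by (intro sum.cong) auto
  then show "\<bar>f i\<bar>\<^sup>2 \<le> (vec_norm2 (mat_diag n f *\<^sub>v unit_vec n i))\<^sup>2"
    using assms by (simp add: vec_norm2_mat_diag)
qed (auto intro: sum_nonneg)

section \<open>Matrices with four diagonal blocks\<close>

text \<open>Four diagonal blocks are a direct sum of the \<open>2 \<times> 2\<close> matrices with rows
  \<open>(a i, b i)\<close>, \<open>(c i, d i)\<close>.\<close>
definition block2 ::
  "nat \<Rightarrow> (nat \<Rightarrow> real) \<Rightarrow> (nat \<Rightarrow> real) \<Rightarrow> (nat \<Rightarrow> real) \<Rightarrow> (nat \<Rightarrow> real) \<Rightarrow> real mat" where
  "block2 N a b c d =
     four_block_mat (mat_diag N a) (mat_diag N b) (mat_diag N c) (mat_diag N d)"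

lemma block2_carrier [simp]: "block2 N a b c d \<in> carrier_mat (N + N) (N + N)"
  by (simp add: block2_def)

lemma block2_dim [simp]: "dim_row (block2 N a b c d) = N + N" "dim_col (block2 N a b c d) = N + N"
  by (simp_all add: block2_def)

lemma block2_mult:
  "block2 N a b c d * block2 N a' b' c' d' =
   block2 N (\<lambda>i. a i * a' i + b i * c' i) (\<lambda>i. a i * b' i + b i * d' i)
            (\<lambda>i. c i * a' i + d i * c' i) (\<lambda>i. c i * b' i + d i * d' i)"
  unfolding block2_def
  by (subst mult_four_block_mat[OF mat_diag_dim mat_diag_dim mat_diag_dim mat_diag_dim
        mat_diag_dim mat_diag_dim mat_diag_dim mat_diag_dim]) (simp add: mat_diag_arith)

lemma block2_cong:
  assumes "\<And>i. i < N \<Longrightarrow> a i = a' i" "\<And>i. i < N \<Longrightarrow> b i = b' i"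
    "\<And>i. i < N \<Longrightarrow> c i = c' i" "\<And>i. i < N \<Longrightarrow> d i = d' i"
  shows "block2 N a b c d = block2 N a' b' c' d'"
proof -
  have "mat_diag N a = mat_diag N a'" "mat_diag N b = mat_diag N b'"
    "mat_diag N c = mat_diag N c'" "mat_diag N d = mat_diag N d'"
    using assms by (simp_all add: mat_diag_eq_iff)
  then show ?thesis by (simp add: block2_def)
qed

lemma block2_one: "block2 N (\<lambda>_. 1) (\<lambda>_. 0) (\<lambda>_. 0) (\<lambda>_. 1) = 1\<^sub>m (N + N)"
  by (auto simp: block2_def intro!: eq_matI)

lemma block2_mult_vec:
  assumes "v \<in> carrier_vec (N + N)"
  shows "block2 N a b c d *\<^sub>v v =
    vec N (\<lambda>i. a i * v $ i + b i * v $ (N + i)) @\<^sub>v vec N (\<lambda>i. c i * v $ i + d i * v $ (N + i))"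
proof -
  let ?u = "vec_first v N" and ?w = "vec_last v N"
  have "block2 N a b c d *\<^sub>v (?u @\<^sub>v ?w) =
    (mat_diag N a *\<^sub>v ?u + mat_diag N b *\<^sub>v ?w) @\<^sub>v (mat_diag N c *\<^sub>v ?u + mat_diag N d *\<^sub>v ?w)"
    unfolding block2_def by (rule four_block_mat_mult_vec) auto
  also have "?u @\<^sub>v ?w = v" by (rule vec_first_last_append[OF assms])
  finally show ?thesis
    using assms by (auto simp: mat_diag_mult_vec vec_first_def vec_last_def intro!: arg_cong2[of _ _ _ _ append_vec] eq_vecI)
qed

text \<open>Pairs coordinate \<open>i\<close> with \<open>N + i\<close>, the two coordinates on
  which the \<open>i\<close>-th 2 by 2 block acts, so that squared norms split into a sum over
  planes.\<close>

lemma sum_lessThan_double: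
  fixes f :: "nat \<Rightarrow> real"
  shows "(\<Sum>i<N + N. f i) = (\<Sum>i<N. f i + f (N + i))"
proof -
  have "(\<Sum>i<N + M. f i) = (\<Sum>i<N. f i) + (\<Sum>i<M. f (N + i))" for M
    by (induction M) (simp_all add: add.assoc)
  then show ?thesis by (simp add: sum.distrib)
qed

lemma vec_norm2_block2:
  assumes "v \<in> carrier_vec (N + N)"
  shows "(vec_norm2 (block2 N a b c d *\<^sub>v v))\<^sup>2 =
    (\<Sum>i<N. (a i * v $ i + b i * v $ (N + i))\<^sup>2 + (c i * v $ i + d i * v $ (N + i))\<^sup>2)"
  unfolding block2_mult_vec[OF assms] vec_norm2_sq by (simp add: sum_lessThan_double)

lemma vec_norm2_block2_le:
  assumes "\<And>i x y. i < N \<Longrightarrow> (a i * x + b i * y)\<^sup>2 + (c i * x + d i * y)\<^sup>2 \<le> C\<^sup>2 * (x\<^sup>2 + y\<^sup>2)"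
    and "v \<in> carrier_vec (N + N)"
  shows "(vec_norm2 (block2 N a b c d *\<^sub>v v))\<^sup>2 \<le> C\<^sup>2 * (vec_norm2 v)\<^sup>2"
proof -
  have "(vec_norm2 v)\<^sup>2 = (\<Sum>i<N. (v $ i)\<^sup>2 + (v $ (N + i))\<^sup>2)"
    using assms(2) by (simp add: vec_norm2_sq sum_lessThan_double)
  then show ?thesis
    unfolding vec_norm2_block2[OF assms(2)]
    by (simp only: sum_distrib_left) (intro sum_mono assms(1), simp)
qed

lemma spec_norm_block2_le:
  assumes "N > 0" "C \<ge> 0"
    and "\<And>i x y. i < N \<Longrightarrow> (a i * x + b i * y)\<^sup>2 + (c i * x + d i * y)\<^sup>2 \<le> C\<^sup>2 * (x\<^sup>2 + y\<^sup>2)"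
  shows "spec_norm (block2 N a b c d) \<le> C"
  using assms vec_norm2_block2_le[OF assms(3)] by (intro spec_norm_le) auto

text \<open>The test vector is the \<open>j\<close>-th unit vector, whose image is the first column
  of the \<open>j\<close>-th 2 by 2 block.\<close>

lemma spec_norm_block2_ge:
  assumes "C \<ge> 0"
    and "\<And>i x y. i < N \<Longrightarrow> (a i * x + b i * y)\<^sup>2 + (c i * x + d i * y)\<^sup>2 \<le> C\<^sup>2 * (x\<^sup>2 + y\<^sup>2)"
    and "j < N" "e\<^sup>2 \<le> (a j)\<^sup>2 + (c j)\<^sup>2"
  shows "e \<le> spec_norm (block2 N a b c d)"
proof (rule spec_norm_ge[OF assms(1)])
  show "(vec_norm2 (block2 N a b c d *\<^sub>v v))\<^sup>2 \<le> C\<^sup>2 * (vec_norm2 v)\<^sup>2"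
    if "v \<in> carrier_vec (dim_col (block2 N a b c d))" for v
    using that by (intro vec_norm2_block2_le[OF assms(2)]) auto
  show "vec_norm2 (unit_vec (N + N) j) = 1" using assms(3) by (simp add: vec_norm2_unit_vec)
  let ?v = "unit_vec (N + N) j :: real vec"
  have "(\<Sum>i<N. (a i * ?v $ i + b i * ?v $ (N + i))\<^sup>2 + (c i * ?v $ i + d i * ?v $ (N + i))\<^sup>2)
      = (\<Sum>i<N. if i = j then (a j)\<^sup>2 + (c j)\<^sup>2 else 0)"
    using assms(3) by (intro sum.cong) auto
  then show "e\<^sup>2 \<le> (vec_norm2 (block2 N a b c d *\<^sub>v ?v))\<^sup>2"
    using assms(3,4) by (simp add: vec_norm2_block2)
qed auto

section \<open>Diagonalisation and the eigenvalue list\<close>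

lemma diagonal_mat_eq_mat_diag:
  assumes "A \<in> carrier_mat n n" "diagonal_mat A"
  shows "A = mat_diag n (\<lambda>i. A $$ (i, i))"
  using assms by (intro eq_matI) (auto simp: diagonal_mat_def)

lemma one_mat_eq_mat_diag: "1\<^sub>m n = mat_diag n (\<lambda>_. 1)"
  by simp

lemma zero_mat_eq_mat_diag: "0\<^sub>m n n = mat_diag n (\<lambda>_. 0)"
  by (intro eq_matI) auto

text \<open>\<open>case_nat\<close> puts the leading entry at index 0, so entry \<open>i\<close> of
  the lower block sits at \<open>Suc i\<close>.\<close>

lemma diag_block_mat_mat_diag:
  "diag_block_mat [mat_diag 1 (\<lambda>_. x), mat_diag m g] = mat_diag (Suc m) (case_nat x g)"
  by (intro eq_matI) (auto simp: Let_def split: nat.split)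

text \<open>Conjugating back with the transpose recovers the middle factor. This allows diagonals to
  be compared once two matrices are diagonalised by the same \<open>U\<close>.\<close>

lemma orthogonal_conj_cancel:
  fixes U :: "real mat"
  assumes "U \<in> carrier_mat n n" "transpose_mat U * U = 1\<^sub>m n"
    and "D \<in> carrier_mat n n" "E \<in> carrier_mat n n"
    and "U * D * transpose_mat U = U * E * transpose_mat U"
  shows "D = E"
proof -
  have cancel: "transpose_mat U * (U * X * transpose_mat U) * U = X" if X: "X \<in> carrier_mat n n" for X
  proof -
    have T: "transpose_mat U \<in> carrier_mat n n" using assms(1) by simp
    have "transpose_mat U * (U * X * transpose_mat U) * U
        = (transpose_mat U * U) * X * (transpose_mat U * U)"
      using assms(1) T X by (simp add: assoc_mult_mat[of _ n n _ n _ n])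
    then show ?thesis using assms(2) X by simp
  qed
  show ?thesis using cancel[OF assms(3)] cancel[OF assms(4)] unfolding assms(5) by (rule trans[OF sym])
qed

lemma proots_prod_linear: "proots (\<Prod>a\<leftarrow>xs. [:- a, 1:]) = mset (xs :: real list)"
proof (induction xs)
  case (Cons a xs)
  have "(\<Prod>a\<leftarrow>xs. [:- a, 1:]) \<noteq> 0" by (auto simp: prod_list_zero_iff)
  then show ?case using Cons proots_mult[of "[:- a, 1:]" "\<Prod>a\<leftarrow>xs. [:- a, 1:]"] by (simp del: mult_pCons_left)
qed simp

text \<open>\<open>eigs\<close> lists only real roots, so in general it may be shorter than
  \<open>n\<close>; similarity to a diagonal matrix splits the characteristic polynomial into
  \<open>n\<close> linear factors.\<close>

lemma length_eigs_of_diagonalised: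
  assumes "U \<in> carrier_mat n n" "U * transpose_mat U = 1\<^sub>m n" "transpose_mat U * U = 1\<^sub>m n"
    and "W = U * mat_diag n f * transpose_mat U"
  shows "length (eigs W) = n"
proof -
  have "similar_mat W (mat_diag n f)"
    using assms by (intro similar_matI[of _ _ U "transpose_mat U" n]) auto
  then have "char_poly W = char_poly (mat_diag n f)" by (rule char_poly_similar)
  also have "\<dots> = (\<Prod>a\<leftarrow>diag_mat (mat_diag n f). [:- a, 1:])"
    by (rule char_poly_upper_triangular[of _ n]) auto
  finally have "proots (char_poly W) = mset (diag_mat (mat_diag n f))"
    by (simp add: proots_prod_linear)
  then show ?thesis
    unfolding eigs_def
    by (metis diag_mat_def diff_zero length_map length_rev length_upt mat_diag_index(2)
        mset_sorted_list_of_multiset size_mset)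
qed

lemma eigs_antimono:
  assumes "i \<le> j" "j < length (eigs W)"
  shows "eigs W ! j \<le> eigs W ! i"
proof -
  define xs where "xs = sorted_list_of_multiset (proots (char_poly W))"
  have xs: "eigs W = rev xs" "sorted xs" by (simp_all add: eigs_def xs_def)
  show ?thesis
    using assms unfolding xs(1) by (auto simp: rev_nth intro: sorted_nth_mono[OF xs(2)])
qed

lemma pos_def_mat_diagD:
  assumes "pos_def (mat_diag n f)" "i < n"
  shows "f i > 0"
proof -
  have "unit_vec n i \<noteq> (0\<^sub>v n :: real vec)"
    using assms(2) by (metis index_unit_vec(2) index_zero_vec(1) zero_neq_one)
  then have "unit_vec n i \<bullet> (mat_diag n f *\<^sub>v unit_vec n i) > 0"
    using assms(1) by (auto simp: pos_def_def)
  then show ?thesis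
    using assms(2) by (simp add: mat_diag_mult_vec scalar_prod_left_unit[of _ n])
qed

text \<open>Quotient and remainder by \<open>d\<close> determine an index, so every off-diagonal
  entry of the Kronecker product has a vanishing factor. Bold matrices thus merely repeat each
  diagonal entry, and norm bounds do not depend on \<open>d\<close>.\<close>

lemma bold_mat_diag:
  assumes "d > 0"
  shows "bold d (mat_diag m f) = mat_diag (m * d) (\<lambda>i. f (i div d))"
proof (rule eq_matI)
  fix i j assume "i < dim_row (mat_diag (m * d) (\<lambda>i. f (i div d)))"
    "j < dim_col (mat_diag (m * d) (\<lambda>i. f (i div d)))"
  then have ij: "i < m * d" "j < m * d" by simp_all
  then have "i div d < m" "j div d < m" "i mod d < d" "j mod d < d"
    using assms by (simp_all add: less_mult_imp_div_less)
  moreover have "i = j" if "i div d = j div d" "i mod d = j mod d"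
    using that by (metis div_mult_mod_eq)
  ultimately show "bold d (mat_diag m f) $$ (i, j) = mat_diag (m * d) (\<lambda>i. f (i div d)) $$ (i, j)"
    using ij by (auto simp: bold_def kron_def)
qed (simp_all add: bold_def kron_def)

text \<open>One \<open>U\<close> diagonalises \<open>W\<close>, \<open>A\<close>,
  \<open>B * B\<close> and \<open>C\<close>, so the relations between these matrices hold entry by
  entry on the diagonals.\<close>

lemma sparkle_spectrum:
  assumes "n \<ge> 2" "\<rho>0 > 0" and mix: "mixing_matrix n \<rho>0 W"
    and sp: "sparkle_matrices var W A B C" and sd: "spectral_data n W A B C U La Lb Lc"
  defines "l \<equiv> \<lambda>i. eigs W ! Suc i"
  shows "\<And>i. i < n - 1 \<Longrightarrow> \<rho>0 \<le> l i \<and> l i \<le> l 0"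
    and "mix_rate W = l 0" "l 0 < 1"
    and "La = mat_diag (n - 1) (case var of ED \<Rightarrow> l | EXTRA \<Rightarrow> (\<lambda>_. 1))"
    and "Lb = mat_diag (n - 1) (\<lambda>i. sqrt (1 - l i))"
    and "Lc = mat_diag (n - 1) l"
proof -
  have W: "W \<in> carrier_mat n n" "\<rho>0 \<le> eigs W ! (n - 1)" "mix_rate W < 1"
    using mix by (auto simp: mixing_matrix_def)
  have U: "U \<in> carrier_mat n n" "U * transpose_mat U = 1\<^sub>m n" "transpose_mat U * U = 1\<^sub>m n"
    using sd by (auto simp: spectral_data_def)
  have n: "n = Suc (n - 1)" using assms(1) by simp
  have conj_diag: "U * diag_block_mat [mat_diag 1 (\<lambda>_. x), mat_diag (n - 1) f] * transpose_mat U
      = U * mat_diag n (case_nat x f) * transpose_mat U" for x f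
    using n diag_block_mat_mat_diag[of x "n - 1" f] by simp
  have "sub_eigs_mat W = mat_diag (n - 1) l"
    using W(1) by (auto simp: sub_eigs_mat_def l_def)
  then have Weq: "W = U * mat_diag n (case_nat 1 l) * transpose_mat U"
    using sd conj_diag[of 1 l] by (simp add: spectral_data_def one_mat_eq_mat_diag del: mat_diag_one)
  \<comment> \<open>There is no circularity: \<open>Weq\<close> uses the values
    \<open>eigs W ! Suc i\<close> merely as diagonal entries, whatever the length of the
    list.\<close>
  have len: "length (eigs W) = n"
    using length_eigs_of_diagonalised[OF U Weq] .
  show bounds: "\<rho>0 \<le> l i \<and> l i \<le> l 0" if "i < n - 1" for i
    using that eigs_antimono[of "Suc i" "n - 1" W] eigs_antimono[of 1 "Suc i" W] W(2) len
    by (auto simp: l_def)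
  \<comment> \<open>The list descends and its last entry is at least \<rho>0 > 0, so the absolute
    values drop and the second entry is the maximum.\<close>
  have "eigs W ! (n - 1) \<le> eigs W ! 1"
    using eigs_antimono[of 1 "n - 1" W] len assms(1) by simp
  then show mr: "mix_rate W = l 0"
    using W assms(1,2) by (simp add: mix_rate_def l_def)
  with W(3) show "l 0 < 1" by simp
  have diag_inj: "\<And>i. i < n - 1 \<Longrightarrow> f i = g i"
    if eq: "U * mat_diag n (case_nat x f) * transpose_mat U = U * mat_diag n (case_nat y g) * transpose_mat U"
    for x y f g
  proof -
    fix i assume "i < n - 1"
    moreover have "mat_diag n (case_nat x f) = mat_diag n (case_nat y g)"
      by (rule orthogonal_conj_cancel[OF U(1,3) mat_diag_dim mat_diag_dim eq])
    ultimately show "f i = g i" using n by (auto simp: mat_diag_eq_iff dest: spec[of _ "Suc i"])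
  qed
  define a b c where "a = (\<lambda>i. La $$ (i, i))" and "b = (\<lambda>i. Lb $$ (i, i))" and "c = (\<lambda>i. Lc $$ (i, i))"
  have La: "La = mat_diag (n - 1) a" and Lb: "Lb = mat_diag (n - 1) b" and Lc: "Lc = mat_diag (n - 1) c"
    using sd by (auto simp: spectral_data_def a_def b_def c_def intro: diagonal_mat_eq_mat_diag)
  have C: "C = U * mat_diag n (case_nat 1 c) * transpose_mat U"
    using sd conj_diag[of 1 c] by (simp add: spectral_data_def Lc one_mat_eq_mat_diag del: mat_diag_one)
  have "C = W" using sp by (cases var) auto
  with C Weq have "c i = l i" if "i < n - 1" for i using diag_inj[of 1 c 1 l] that by simp
  then show "Lc = mat_diag (n - 1) l" by (simp add: Lc mat_diag_eq_iff)
  have A: "A = U * mat_diag n (case_nat 1 a) * transpose_mat U"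
    using sd conj_diag[of 1 a] by (simp add: spectral_data_def La one_mat_eq_mat_diag del: mat_diag_one)
  \<comment> \<open>The identity is written in conjugated form too, as needed for \<open>A\<close>
    in EXTRA and for the difference of the identity and \<open>W\<close>.\<close>
  have "case_nat 1 (\<lambda>_. 1) = (\<lambda>_::nat. 1 :: real)" by (auto split: nat.split)
  then have one: "1\<^sub>m n = U * mat_diag n (case_nat 1 (\<lambda>_. 1)) * transpose_mat U"
    using U by simp
  show "La = mat_diag (n - 1) (case var of ED \<Rightarrow> l | EXTRA \<Rightarrow> (\<lambda>_. 1))"
  proof (cases var)
    case ED
    with sp A Weq have "a i = l i" if "i < n - 1" for i using diag_inj[of 1 a 1 l] that by simp
    then show ?thesis by (simp add: La mat_diag_eq_iff ED)
  next
    case EXTRA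
    with sp A one W(1) have "a i = 1" if "i < n - 1" for i
      using diag_inj[of 1 a 1 "\<lambda>_. 1"] that by simp
    then show ?thesis by (simp add: La mat_diag_eq_iff EXTRA del: mat_diag_one)
  qed
  have "B * B = 1\<^sub>m n - W" using sp W(1) by (cases var) (auto simp: is_sqrt_mat_def)
  also have "\<dots> = U * mat_diag n (case_nat 1 (\<lambda>_. 1)) * transpose_mat U
      - U * mat_diag n (case_nat 1 l) * transpose_mat U"
    using one Weq by simp
  also have "\<dots> = U * (mat_diag n (case_nat 1 (\<lambda>_. 1)) - mat_diag n (case_nat 1 l)) * transpose_mat U"
    using U(1) by (simp add: minus_mult_distrib_mat[of _ n n _ _ n] mult_minus_distrib_mat[of _ n n _ n])
  also have "mat_diag n (case_nat 1 (\<lambda>_. 1)) - mat_diag n (case_nat 1 l) = mat_diag n (case_nat 0 (\<lambda>i. 1 - l i))"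
    by (auto simp: mat_diag_arith mat_diag_eq_iff split: nat.split)
  finally have "B * B = U * mat_diag n (case_nat 0 (\<lambda>i. 1 - l i)) * transpose_mat U" .
  moreover have "B * B = U * mat_diag n (case_nat 0 (\<lambda>i. b i * b i)) * transpose_mat U"
    using sd conj_diag[of 0 "\<lambda>i. b i * b i"] by (simp add: spectral_data_def Lb zero_mat_eq_mat_diag)
  ultimately have bb: "b i * b i = 1 - l i" if "i < n - 1" for i
    using diag_inj[of 0 "\<lambda>i. b i * b i" 0 "\<lambda>i. 1 - l i"] that by simp
  \<comment> \<open>Positive definiteness of \<open>Lb\<close> selects the positive root of
    \<open>bb\<close>.\<close>
  have "b i > 0" if "i < n - 1" for i
    using sd that by (intro pos_def_mat_diagD[of "n - 1" b]) (auto simp: spectral_data_def Lb)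
  then have "b i = sqrt (1 - l i)" if "i < n - 1" for i
    using that bb[OF that, symmetric] by (simp add: less_imp_le)
  then show "Lb = mat_diag (n - 1) (\<lambda>i. sqrt (1 - l i))" by (simp add: Lb mat_diag_eq_iff)
qed

section \<open>The explicit factorization of \<open>M\<close> and its norms\<close>

text \<open>
  On the plane of one eigenvalue \<open>\<lambda>\<close>, with \<open>b = \<surd>(1 - \<lambda>)\<close>, the matrix \<open>M\<close> has the complex pair
  of eigenvalues of modulus \<open>\<surd>\<lambda>\<close>, and it scales the quadratic form with matrix
  \<open>S = ((1, b), (b, 1))\<close> by \<open>\<lambda>\<close>. The factor \<open>O\<close> is \<open>R\<^sup>-\<^sup>1\<close> for the Cholesky factor \<open>R\<close> of
  \<open>S\<close>; then \<open>\<Gamma> = R M R\<^sup>-\<^sup>1\<close> is \<open>\<surd>\<lambda>\<close> times a rotation.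
\<close>
definition Ofac :: "nat \<Rightarrow> (nat \<Rightarrow> real) \<Rightarrow> real mat" where
  "Ofac N b = block2 N (\<lambda>_. 1) (\<lambda>i. - b i / sqrt (1 - (b i)\<^sup>2)) (\<lambda>_. 0) (\<lambda>i. 1 / sqrt (1 - (b i)\<^sup>2))"

definition Rfac :: "nat \<Rightarrow> (nat \<Rightarrow> real) \<Rightarrow> real mat" where
  "Rfac N b = block2 N (\<lambda>_. 1) b (\<lambda>_. 0) (\<lambda>i. sqrt (1 - (b i)\<^sup>2))"

definition Gammafac :: "nat \<Rightarrow> (nat \<Rightarrow> real) \<Rightarrow> real mat" where
  "Gammafac N b = block2 N (\<lambda>i. 1 - (b i)\<^sup>2) (\<lambda>i. - (sqrt (1 - (b i)\<^sup>2) * b i))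
     (\<lambda>i. sqrt (1 - (b i)\<^sup>2) * b i) (\<lambda>i. 1 - (b i)\<^sup>2)"

lemma M_mat_mat_diag:
  "M_mat (mat_diag N b) (mat_diag N c) = block2 N (\<lambda>i. c i - b i * b i) (\<lambda>i. - b i) b (\<lambda>_. 1)"
  by (simp add: M_mat_def block2_def mat_diag_arith)

lemma minv_Ofac:
  assumes "\<And>i. i < N \<Longrightarrow> (b i)\<^sup>2 < 1"
  shows "Ofac N b * Rfac N b = 1\<^sub>m (N + N)" "Rfac N b * Ofac N b = 1\<^sub>m (N + N)"
    "minv (Ofac N b) = Rfac N b"
proof -
  show "Ofac N b * Rfac N b = 1\<^sub>m (N + N)" "Rfac N b * Ofac N b = 1\<^sub>m (N + N)"
    unfolding Ofac_def Rfac_def block2_mult block2_one[symmetric]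
    using assms by (auto intro!: block2_cong simp: less_le)
  then show "minv (Ofac N b) = Rfac N b"
    by (intro minv_eqI) (auto simp: Ofac_def Rfac_def)
qed

text \<open>The relation between \<open>c\<close> and \<open>b\<close> is
  \<open>b = sqrt (1 - \<lambda>)\<close> solved for \<lambda>. With it, the identity is checked
  entrywise on each 2 by 2 block.\<close>

lemma factorization_identity:
  assumes "\<And>i. i < N \<Longrightarrow> (b i)\<^sup>2 < 1" "\<And>i. i < N \<Longrightarrow> c i = 1 - (b i)\<^sup>2"
  shows "M_mat (mat_diag N b) (mat_diag N c) = Ofac N b * Gammafac N b * Rfac N b"
proof -
  have s: "sqrt (1 - (b i)\<^sup>2) * sqrt (1 - (b i)\<^sup>2) = 1 - (b i)\<^sup>2" "sqrt (1 - (b i)\<^sup>2) > 0"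
    if "i < N" for i using assms(1)[OF that] by simp_all
  show ?thesis
    unfolding M_mat_mat_diag Ofac_def Rfac_def Gammafac_def block2_mult
    by (rule block2_cong; frule s(1); frule s(2); simp add: assms(2) field_simps power2_eq_square)
qed

text \<open>The index \<open>j\<close> marks the largest eigenvalue. The lower bounds 1 come from
  the first column (1, 0) of each block of \<open>Ofac\<close> and \<open>Rfac\<close>.\<close>

lemma spec_norm_factors:
  assumes "\<rho>0 > 0" "j < N" and "\<forall>i<N. \<rho>0 \<le> 1 - (b i)\<^sup>2 \<and> 1 - (b i)\<^sup>2 \<le> 1 - (b j)\<^sup>2"
  shows "1 \<le> spec_norm (Ofac N b)" "spec_norm (Ofac N b) \<le> sqrt (2 / \<rho>0)"
    "1 \<le> spec_norm (Rfac N b)" "spec_norm (Rfac N b) \<le> sqrt 2"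
    "spec_norm (Gammafac N b) = sqrt (1 - (b j)\<^sup>2)"
proof -
  note b = assms(3)[rule_format]
  define s where "s = (\<lambda>i. sqrt (1 - (b i)\<^sup>2))"
  have s: "(s i)\<^sup>2 = 1 - (b i)\<^sup>2" "s i > 0" if "i < N" for i
    using b[OF that] assms(1) by (auto simp: s_def)
  have O: "(1 * x + - b i / s i * y)\<^sup>2 + (0 * x + 1 / s i * y)\<^sup>2 \<le> (sqrt (2 / \<rho>0))\<^sup>2 * (x\<^sup>2 + y\<^sup>2)"
    if "i < N" for i x y
  proof -
    \<comment> \<open>Completing the first row to (1, -c) and (c, 1) gives a multiple of a rotation,
      so this row contributes at most 1 / s^2 times the squared length. The second row obeys the
      same bound, hence the factor 2.\<close>
    define c where "c = b i / s i"
    have c: "1 + c\<^sup>2 = 1 / (s i)\<^sup>2"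
      using s[OF that] by (simp add: c_def power_divide field_simps)
    have "(x - c * y)\<^sup>2 = (1 + c\<^sup>2) * (x\<^sup>2 + y\<^sup>2) - (y + c * x)\<^sup>2"
      by (simp add: power2_eq_square algebra_simps)
    then have "(x - c * y)\<^sup>2 \<le> 1 / (s i)\<^sup>2 * (x\<^sup>2 + y\<^sup>2)" unfolding c by simp
    moreover have "(1 / s i * y)\<^sup>2 \<le> 1 / (s i)\<^sup>2 * (x\<^sup>2 + y\<^sup>2)"
      by (simp add: power_mult_distrib power_divide divide_right_mono)
    moreover have "1 / (s i)\<^sup>2 * (x\<^sup>2 + y\<^sup>2) \<le> 1 / \<rho>0 * (x\<^sup>2 + y\<^sup>2)"
      using s(1)[OF that] b[OF that] assms(1) by (intro mult_right_mono frac_le) auto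
    ultimately have "(x - c * y)\<^sup>2 + (1 / s i * y)\<^sup>2 \<le> 2 * (1 / \<rho>0 * (x\<^sup>2 + y\<^sup>2))" by linarith
    then show ?thesis using assms(1) by (simp add: c_def)
  qed
  show "spec_norm (Ofac N b) \<le> sqrt (2 / \<rho>0)"
    unfolding Ofac_def using O assms by (intro spec_norm_block2_le) (auto simp: s_def)
  show "1 \<le> spec_norm (Ofac N b)"
    unfolding Ofac_def using O assms by (intro spec_norm_block2_ge[where C = "sqrt (2 / \<rho>0)" and j = j]) (auto simp: s_def)
  have R: "(1 * x + b i * y)\<^sup>2 + (0 * x + s i * y)\<^sup>2 \<le> (sqrt 2)\<^sup>2 * (x\<^sup>2 + y\<^sup>2)"
    if "i < N" for i x y
  proof -
    \<comment> \<open>Since b^2 + s^2 = 1, adding the form with the roles of \<open>x\<close> and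
      \<open>y\<close> exchanged and \<open>b\<close> negated leaves twice the squared
      length.\<close>
    have "(x + b i * y)\<^sup>2 + (s i)\<^sup>2 * y\<^sup>2 + (y - b i * x)\<^sup>2 + (s i)\<^sup>2 * x\<^sup>2 = 2 * (x\<^sup>2 + y\<^sup>2)"
      unfolding s(1)[OF that] by (simp add: power2_eq_square algebra_simps)
    moreover have "0 \<le> (y - b i * x)\<^sup>2 + (s i)\<^sup>2 * x\<^sup>2" by simp
    ultimately have "(x + b i * y)\<^sup>2 + (s i)\<^sup>2 * y\<^sup>2 \<le> 2 * (x\<^sup>2 + y\<^sup>2)" by linarith
    then show ?thesis by (simp add: power_mult_distrib)
  qed
  show "spec_norm (Rfac N b) \<le> sqrt 2"
    unfolding Rfac_def using R assms(2) by (intro spec_norm_block2_le) (auto simp: s_def)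
  show "1 \<le> spec_norm (Rfac N b)"
    unfolding Rfac_def using R assms(2)
    by (intro spec_norm_block2_ge[where C = "sqrt 2" and j = j]) (auto simp: s_def)
  \<comment> \<open>The block is \<open>s i\<close> times the matrix with rows (s, -b) and (b, s), a
    rotation because s^2 + b^2 = 1.\<close>
  have Geq: "((1 - (b i)\<^sup>2) * x + - (s i * b i) * y)\<^sup>2 + (s i * b i * x + (1 - (b i)\<^sup>2) * y)\<^sup>2
      = (s i)\<^sup>2 * (x\<^sup>2 + y\<^sup>2)" if "i < N" for i x y
  proof -
    have "((1 - (b i)\<^sup>2) * x + - (s i * b i) * y)\<^sup>2 + (s i * b i * x + (1 - (b i)\<^sup>2) * y)\<^sup>2
        = ((1 - (b i)\<^sup>2)\<^sup>2 + (s i)\<^sup>2 * (b i)\<^sup>2) * (x\<^sup>2 + y\<^sup>2)"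
      by (simp add: power2_eq_square algebra_simps)
    also have "(1 - (b i)\<^sup>2)\<^sup>2 + (s i)\<^sup>2 * (b i)\<^sup>2 = (s i)\<^sup>2"
      unfolding s(1)[OF that] by (simp add: power2_eq_square algebra_simps)
    finally show ?thesis .
  qed
  have sj: "(s i)\<^sup>2 \<le> (s j)\<^sup>2" if "i < N" for i using s(1) b that assms(2) by simp
  have G: "((1 - (b i)\<^sup>2) * x + - (s i * b i) * y)\<^sup>2 + (s i * b i * x + (1 - (b i)\<^sup>2) * y)\<^sup>2
      \<le> (s j)\<^sup>2 * (x\<^sup>2 + y\<^sup>2)" if "i < N" for i x y
    unfolding Geq[OF that] using sj[OF that] by (intro mult_right_mono) auto
  have sj0: "0 \<le> s j" using s(2)[OF assms(2)] by simp
  have "spec_norm (Gammafac N b) \<le> s j"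
    unfolding Gammafac_def using G[unfolded s_def] assms(2) sj0[unfolded s_def]
    by (intro spec_norm_block2_le) (auto simp only: s_def)
  moreover have "s j \<le> spec_norm (Gammafac N b)"
    unfolding Gammafac_def
  proof (rule spec_norm_block2_ge[where C = "s j" and j = j])
    show "(s j)\<^sup>2 \<le> (1 - (b j)\<^sup>2)\<^sup>2 + (sqrt (1 - (b j)\<^sup>2) * b j)\<^sup>2"
      using Geq[OF assms(2), of 1 0] by (simp add: s_def)
  qed (use G[unfolded s_def] assms(2) sj0[unfolded s_def] in \<open>auto simp only: s_def\<close>)
  ultimately show "spec_norm (Gammafac N b) = sqrt (1 - (b j)\<^sup>2)" by (simp add: s_def)
qed

section \<open>Estimates of the delta quantities\<close>

lemma spec_norm_minv_mat_diag:
  assumes "N > 0" "m > 0" "\<And>i. i < N \<Longrightarrow> m \<le> b i"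
  shows "0 \<le> spec_norm (minv (mat_diag N b))" "spec_norm (minv (mat_diag N b)) \<le> 1 / m"
proof -
  have pos: "b i > 0" if "i < N" for i using assms(2) assms(3)[OF that] by linarith
  have inv: "minv (mat_diag N b) = mat_diag N (\<lambda>i. 1 / b i)"
    unfolding one_mat_eq_mat_diag using pos
    by (intro minv_eqI) (auto simp: one_mat_eq_mat_diag mat_diag_eq_iff less_imp_neq[symmetric] simp del: mat_diag_one)
  have "\<bar>1 / b i\<bar> \<le> 1 / m" if "i < N" for i
    using pos[OF that] assms(2) assms(3)[OF that] by (simp add: frac_le)
  then show "spec_norm (minv (mat_diag N b)) \<le> 1 / m"
    using spec_norm_mat_diag_le[OF assms(1), of "\<lambda>i. 1 / b i"] by (simp add: inv)
  show "0 \<le> spec_norm (minv (mat_diag N b))"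
    unfolding inv by (rule order_trans[OF abs_ge_zero spec_norm_mat_diag_ge[OF assms(1)]])
qed

text \<open>Everything is counted in powers of \<open>t = 1 / (1 - \<rho>)\<close>: \<open>D\<close>
  lies between \<open>t\<close> and \<open>2 * t\<close>, \<open>m\<close> is at most the square
  root of \<open>t\<close>, and the condition number \<open>P\<close> is absorbed by
  \<open>k\<close>. As \<open>k\<close> is at least 1, the constant 4 k^2 serves all four upper
  bounds.\<close>

lemma delta_bounds:
  fixes \<rho> k :: real
  assumes rho: "0 < \<rho>" "\<rho> < 1"
    and Q: "1 \<le> spec_norm Q" "1 \<le> spec_norm (minv Q)" "(spec_norm Q * spec_norm (minv Q))\<^sup>2 \<le> k"
    and G: "spec_norm G = sqrt \<rho>"
    and La: "0 < \<rho>0" "\<rho>0 \<le> spec_norm La" "spec_norm La \<le> 1"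
    and Lb: "0 \<le> spec_norm (minv Lb)" "spec_norm (minv Lb) \<le> 1 / sqrt (1 - \<rho>)"
  shows "delta_x Q G La \<le> 4 * k\<^sup>2 * (1 - \<rho>) powr (-2)"
    and "delta_yz Q G La \<le> 4 * k\<^sup>2 * (1 - \<rho>) powr (-2)"
    and "delta_hat_x Q G Lb \<le> 4 * k\<^sup>2 * (1 - \<rho>) powr (- (3 / 2))"
    and "delta_hat_yz Q G Lb \<le> 4 * k\<^sup>2 * (1 - \<rho>) powr (-2)"
    and "\<rho>0\<^sup>2 / (1 - \<rho>)\<^sup>2 \<le> delta_yz Q G La"
proof -
  define P where "P = spec_norm Q * spec_norm (minv Q)"
  define D where "D = 1 / (1 - sqrt \<rho>)"
  define t where "t = 1 / (1 - \<rho>)"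
  define m where "m = spec_norm (minv Lb)"
  have P: "1 \<le> P" "P\<^sup>2 \<le> k"
    using Q mult_mono[of 1 "spec_norm Q" 1 "spec_norm (minv Q)"] by (auto simp: P_def)
  have "P \<le> P\<^sup>2" using P(1) by (simp add: power2_eq_square)
  with P have k: "P \<le> k" "1 \<le> k" by linarith+
  have kk: "k \<le> k\<^sup>2" using k(2) by (simp add: power2_eq_square)
  have t: "1 \<le> t" using rho by (simp add: t_def)
  have powr_t: "(1 - \<rho>) powr (- e) = t powr e" for e
    using rho by (simp add: t_def powr_divide powr_minus_divide)
  have t2: "t powr 2 = t\<^sup>2" using t by (simp add: powr_numeral)
  have srho: "sqrt \<rho> < 1" "\<rho> \<le> sqrt \<rho>" "0 < sqrt \<rho>"
    using rho by (auto simp: real_le_rsqrt power2_eq_square mult_left_le)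
  have "1 - \<rho> = (1 - sqrt \<rho>) * (1 + sqrt \<rho>)" using rho by (simp add: algebra_simps)
  also have "\<dots> \<le> (1 - sqrt \<rho>) * 2" using srho by (intro mult_left_mono) auto
  finally have D: "D \<le> 2 * t" "t \<le> D"
    using srho rho by (auto simp: D_def t_def field_simps)
  have D0: "0 \<le> D" using D t by linarith
  have mt: "m \<le> t powr (1 / 2)" "0 \<le> m"
    using Lb rho by (simp_all add: m_def t_def powr_half_sqrt real_sqrt_divide)
  have "m\<^sup>2 \<le> (t powr (1 / 2))\<^sup>2" using mt by (intro power_mono) auto
  also have "\<dots> = t" using t by (simp add: powr_half_sqrt)
  finally have m2: "m\<^sup>2 \<le> t" .
  have "delta_x Q G La = (P * D * spec_norm La)\<^sup>2" by (simp add: delta_x_def P_def D_def G)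
  also have "\<dots> \<le> (k * (2 * t) * 1)\<^sup>2"
    using P k D D0 La by (intro power_mono mult_mono) auto
  finally show "delta_x Q G La \<le> 4 * k\<^sup>2 * (1 - \<rho>) powr (-2)"
    by (simp add: powr_t t2 power_mult_distrib)
  have dyz: "delta_yz Q G La = (P\<^sup>2 * D)\<^sup>2 * (spec_norm La)\<^sup>2"
    by (simp add: delta_yz_def P_def D_def G power_mult_distrib)
  have "(P\<^sup>2 * D)\<^sup>2 * (spec_norm La)\<^sup>2 \<le> (k * (2 * t))\<^sup>2 * 1\<^sup>2"
    using P k D D0 La by (intro power_mono mult_mono) auto
  then show "delta_yz Q G La \<le> 4 * k\<^sup>2 * (1 - \<rho>) powr (-2)"
    by (simp add: dyz powr_t t2 power_mult_distrib)
  \<comment> \<open>For the lower bound, \<open>P\<close> is replaced by 1, \<open>D\<close> by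
    \<open>t\<close> and the norm of \<open>La\<close> by \<rho>0.\<close>
  have "(1 * t)\<^sup>2 * \<rho>0\<^sup>2 \<le> (P\<^sup>2 * D)\<^sup>2 * (spec_norm La)\<^sup>2"
    using P D D0 La t by (intro mult_mono power_mono) auto
  then show "\<rho>0\<^sup>2 / (1 - \<rho>)\<^sup>2 \<le> delta_yz Q G La"
    by (simp add: dyz t_def power_divide)
  have "P * m * D \<le> k * t powr (1 / 2) * (2 * t)"
    using P k D D0 mt t by (intro mult_mono) auto
  also have "\<dots> = 2 * k * (t powr (1 / 2) * t powr 1)" using t by simp
  also have "\<dots> = 2 * k * t powr (3 / 2)" by (simp only: powr_add[symmetric]) simp
  finally have PmD: "P * m * D \<le> 2 * k * t powr (3 / 2)" .
  \<comment> \<open>The first summand of \<open>delta_hat_x\<close> has order t^2 inside the power,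
    hence only t^(4/3); the second one, of order t^(3/2), dominates.\<close>
  have "P\<^sup>2 * m\<^sup>2 * D \<le> k * t * (2 * t)"
    using P k D D0 m2 t by (intro mult_mono) auto
  then have "(P\<^sup>2 * m\<^sup>2 * D) powr (2 / 3) \<le> (2 * k * t powr 2) powr (2 / 3)"
    using D0 t by (intro powr_mono2) (auto simp: t2 power2_eq_square)
  also have "\<dots> = (2 * k) powr (2 / 3) * t powr (4 / 3)"
    using k t by (simp add: powr_mult powr_powr del: powr_numeral)
  also have "\<dots> \<le> (2 * k) powr 1 * t powr (3 / 2)"
    using k t by (intro mult_mono powr_mono) auto
  finally have "(P\<^sup>2 * m\<^sup>2 * D) powr (2 / 3) \<le> 2 * k * t powr (3 / 2)" using k by simp
  moreover have "delta_hat_x Q G Lb = (P\<^sup>2 * m\<^sup>2 * D) powr (2 / 3) + P * m * D"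
    by (simp add: delta_hat_x_def P_def D_def m_def G power_mult_distrib)
  ultimately have "delta_hat_x Q G Lb \<le> 4 * k * t powr (3 / 2)" using PmD by linarith
  also have "\<dots> \<le> 4 * k\<^sup>2 * t powr (3 / 2)" using kk by (intro mult_right_mono) auto
  finally show "delta_hat_x Q G Lb \<le> 4 * k\<^sup>2 * (1 - \<rho>) powr (- (3 / 2))" by (simp only: powr_t)
  \<comment> \<open>The exponents multiply as 3/2 * 4/3 = 2, and the constant is rounded up from (2
    k)^(4/3) to (2 k)^2.\<close>
  have "delta_hat_yz Q G Lb = (P * m * D) powr (4 / 3)"
    by (simp add: delta_hat_yz_def P_def D_def m_def G)
  also have "\<dots> \<le> (2 * k * t powr (3 / 2)) powr (4 / 3)"
    using P D0 mt PmD by (intro powr_mono2) auto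
  also have "\<dots> = (2 * k) powr (4 / 3) * t powr 2"
    using k t by (simp add: powr_mult powr_powr del: powr_numeral)
  also have "\<dots> \<le> (2 * k) powr 2 * t powr 2"
    using k t by (intro mult_right_mono powr_mono) auto
  also have "(2 * k) powr 2 = 4 * k\<^sup>2" using k by (simp add: powr_numeral power_mult_distrib)
  finally show "delta_hat_yz Q G Lb \<le> 4 * k\<^sup>2 * (1 - \<rho>) powr (-2)" by (simp only: powr_t)
qed

section \<open>Factors read off from \<open>M\<close>, and the bounds for one block\<close>

text \<open>The factors have to be functions of \<open>M\<close> alone; the entries \<open>b i\<close> are read off its lower
  left block.\<close>
definition Ofac_of :: "real mat \<Rightarrow> real mat" where
  "Ofac_of M = Ofac (dim_row M div 2) (\<lambda>i. M $$ (dim_row M div 2 + i, i))"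

definition Gammafac_of :: "real mat \<Rightarrow> real mat" where
  "Gammafac_of M = Gammafac (dim_row M div 2) (\<lambda>i. M $$ (dim_row M div 2 + i, i))"

lemma factors_of_M_mat:
  fixes b c :: "nat \<Rightarrow> real" and N :: nat
  defines "M \<equiv> M_mat (mat_diag N b) (mat_diag N c)"
  shows "dim_row M = N + N" "Ofac_of M = Ofac N b" "Gammafac_of M = Gammafac N b"
proof -
  have M: "M = block2 N (\<lambda>i. c i - b i * b i) (\<lambda>i. - b i) b (\<lambda>_. 1)"
    by (simp add: M_def M_mat_mat_diag)
  then show dim: "dim_row M = N + N" by simp
  have half: "(N + N) div 2 = N" by simp
  have "M $$ (N + i, i) = b i" if "i < N" for i using that by (simp add: M block2_def)
  then show "Ofac_of M = Ofac N b" "Gammafac_of M = Gammafac N b"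
    unfolding Ofac_of_def Gammafac_of_def dim half Ofac_def Gammafac_def
    by (auto intro!: block2_cong)
qed

lemma sparkle_block_bounds:
  assumes "n \<ge> 2" "d \<ge> 1" "\<rho>0 > 0" and mix: "mixing_matrix n \<rho>0 W"
    and sp: "sparkle_matrices var W A B C" and sd: "spectral_data n W A B C U La Lb Lc"
  defines "M \<equiv> M_mat (bold d Lb) (bold d Lc)"
  defines "Q \<equiv> Ofac_of M" and "G \<equiv> Gammafac_of M"
  shows "factorization M Q G"
    and "delta_x Q G (bold d La) \<le> 4 * (4 / \<rho>0)\<^sup>2 * (1 - mix_rate W) powr (-2)"
    and "delta_yz Q G (bold d La) \<le> 4 * (4 / \<rho>0)\<^sup>2 * (1 - mix_rate W) powr (-2)"
    and "delta_hat_x Q G (bold d Lb) \<le> 4 * (4 / \<rho>0)\<^sup>2 * (1 - mix_rate W) powr (- (3 / 2))"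
    and "delta_hat_yz Q G (bold d Lb) \<le> 4 * (4 / \<rho>0)\<^sup>2 * (1 - mix_rate W) powr (-2)"
    and "\<rho>0\<^sup>2 / (1 - mix_rate W)\<^sup>2 \<le> delta_yz Q G (bold d La)"
    and "0 < mix_rate W" "mix_rate W < 1"
proof -
  note spectrum = sparkle_spectrum[OF assms(1,3) mix sp sd]
  define N where "N = (n - 1) * d"
  define L b a where "L = (\<lambda>i. eigs W ! Suc (i div d))" and "b = (\<lambda>i. sqrt (1 - L i))"
    and "a = (\<lambda>i. case var of ED \<Rightarrow> L i | EXTRA \<Rightarrow> 1)"
  have d: "d > 0" and N: "N > 0" using assms(1,2) by (auto simp: N_def)
  have bLa: "bold d La = mat_diag N a" and bLb: "bold d Lb = mat_diag N b" and bLc: "bold d Lc = mat_diag N L"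
    unfolding spectrum(4-6) bold_mat_diag[OF d] by (auto simp: N_def L_def b_def a_def mat_diag_eq_iff simp del: mat_diag_one split: variant.split)
  have L: "\<rho>0 \<le> L i" "L i \<le> L 0" if "i < N" for i
    using spectrum(1)[of "i div d"] that by (auto simp: L_def N_def less_mult_imp_div_less)
  have mr: "mix_rate W = L 0" using spectrum(2) by (simp add: L_def)
  have L1: "L 0 < 1" and L0: "0 < L 0"
    using spectrum(3) L(1)[OF N] assms(3) by (auto simp: L_def)
  show "0 < mix_rate W" "mix_rate W < 1" using L0 L1 mr by simp_all
  have b2: "(b i)\<^sup>2 = 1 - L i" if "i < N" for i using L(2)[OF that] L1 by (simp add: b_def)
  have b_lt: "(b i)\<^sup>2 < 1" and L_b: "L i = 1 - (b i)\<^sup>2" if "i < N" for i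
    using b2[OF that] L(1)[OF that] assms(3) by auto
  have M: "M = M_mat (mat_diag N b) (mat_diag N L)" by (simp add: M_def bLb bLc)
  have Q: "Q = Ofac N b" and G: "G = Gammafac N b" and dimM: "dim_row M = N + N"
    unfolding Q_def G_def M by (rule factors_of_M_mat)+
  have minvQ: "minv Q = Rfac N b" unfolding Q by (rule minv_Ofac(3)[OF b_lt])
  \<comment> \<open>Index 0 carries the largest of the eigenvalues, so it is the \<open>j\<close> of
    \<open>spec_norm_factors\<close>.\<close>
  have "\<forall>i<N. \<rho>0 \<le> 1 - (b i)\<^sup>2 \<and> 1 - (b i)\<^sup>2 \<le> 1 - (b 0)\<^sup>2"
    using L L_b[symmetric] N by simp
  note norms = spec_norm_factors[OF assms(3) N this, folded minvQ, folded Q G]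
  have normG: "spec_norm G = sqrt (mix_rate W)" using norms(5) L_b[OF N] mr by simp
  have "spec_norm G < 1" using normG L1 mr by simp
  moreover have "invertible_mat Q"
    unfolding invertible_mat_def inverts_mat_def
    using minv_Ofac(1,2)[OF b_lt] by (auto simp: Q Ofac_def Rfac_def intro!: exI[of _ "Rfac N b"])
  moreover have "M = Q * G * minv Q"
    unfolding minvQ unfolding M Q G by (rule factorization_identity[OF b_lt L_b])
  ultimately show "factorization M Q G"
    unfolding factorization_def dimM by (simp add: Q G Ofac_def Gammafac_def)
  \<comment> \<open>The squared product of the two norm bounds, 4 / \<rho>0, is the \<open>k\<close>
    of \<open>delta_bounds\<close>.\<close>
  have "spec_norm Q * spec_norm (minv Q) \<le> sqrt (2 / \<rho>0) * sqrt 2"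
    using norms assms(3) by (intro mult_mono) auto
  then have "(spec_norm Q * spec_norm (minv Q))\<^sup>2 \<le> (sqrt (2 / \<rho>0) * sqrt 2)\<^sup>2"
    using norms by (intro power_mono) auto
  also have "\<dots> = 4 / \<rho>0" using assms(3) by (simp add: power_mult_distrib)
  finally have cond: "(spec_norm Q * spec_norm (minv Q))\<^sup>2 \<le> 4 / \<rho>0" .
  \<comment> \<open>The diagonal of \<open>La\<close> consists of eigenvalues for ED and of ones for
    EXTRA; both lie in [\<rho>0, 1], which treats the variants together.\<close>
  have a: "\<rho>0 \<le> a i" "a i \<le> 1" if "i < N" for i
    using L[OF that] L1 by (auto simp: a_def L_def split: variant.split)
  have La: "\<rho>0 \<le> spec_norm (bold d La)" "spec_norm (bold d La) \<le> 1"
  proof -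
    have "\<bar>a i\<bar> \<le> 1" if "i < N" for i using a[OF that] assms(3) by simp
    then show "spec_norm (bold d La) \<le> 1" unfolding bLa by (rule spec_norm_mat_diag_le[OF N])
    show "\<rho>0 \<le> spec_norm (bold d La)"
      unfolding bLa using a(1)[OF N] spec_norm_mat_diag_ge[OF N, of a] by linarith
  qed
  have "sqrt (1 - mix_rate W) \<le> b i" if "i < N" for i using L(2)[OF that] mr by (simp add: b_def)
  then have Lb: "0 \<le> spec_norm (minv (bold d Lb))" "spec_norm (minv (bold d Lb)) \<le> 1 / sqrt (1 - mix_rate W)"
    unfolding bLb using spec_norm_minv_mat_diag[OF N, of "sqrt (1 - mix_rate W)" b] L1 mr by simp_all
  have mr01: "0 < mix_rate W" "mix_rate W < 1" using L0 L1 mr by simp_all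
  note bounds = delta_bounds[OF mr01 norms(1,3) cond normG assms(3) La Lb]
  show "delta_x Q G (bold d La) \<le> 4 * (4 / \<rho>0)\<^sup>2 * (1 - mix_rate W) powr (-2)"
    "delta_yz Q G (bold d La) \<le> 4 * (4 / \<rho>0)\<^sup>2 * (1 - mix_rate W) powr (-2)"
    "delta_hat_x Q G (bold d Lb) \<le> 4 * (4 / \<rho>0)\<^sup>2 * (1 - mix_rate W) powr (- (3 / 2))"
    "delta_hat_yz Q G (bold d Lb) \<le> 4 * (4 / \<rho>0)\<^sup>2 * (1 - mix_rate W) powr (-2)"
    "\<rho>0\<^sup>2 / (1 - mix_rate W)\<^sup>2 \<le> delta_yz Q G (bold d La)"
    by (rule bounds)+
qed

section \<open>Transient complexity and assembly\<close>

lemma transient_complexity_order: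
  fixes \<rho> K c :: real
  assumes n: "n \<ge> 1" and K: "K > 0" and rho: "0 < \<rho>" "\<rho> < 1"
    and up: "dx \<le> K * (1 - \<rho>) powr (-2)" "dy \<le> K * (1 - \<rho>) powr (-2)" "dz \<le> K * (1 - \<rho>) powr (-2)"
      "hx \<le> K * (1 - \<rho>) powr (- (3 / 2))" "hy \<le> K * (1 - \<rho>) powr (-2)" "hz \<le> K * (1 - \<rho>) powr (-2)"
    and low: "c / (1 - \<rho>)\<^sup>2 \<le> dy"
  shows "c * (real n ^ 3 / (1 - \<rho>)\<^sup>2) \<le> transient_complexity n dx dy dz hx hy hz"
    and "transient_complexity n dx dy dz hx hy hz \<le> K * (real n ^ 3 / (1 - \<rho>)\<^sup>2)"
proof -
  have "c * (real n ^ 3 / (1 - \<rho>)\<^sup>2) = real n ^ 3 * (c / (1 - \<rho>)\<^sup>2)" by simp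
  also have "\<dots> \<le> real n ^ 3 * dy" using low by (intro mult_left_mono) auto
  also have "\<dots> \<le> transient_complexity n dx dy dz hx hy hz"
    unfolding transient_complexity_def by (intro Max_ge) auto
  finally show "c * (real n ^ 3 / (1 - \<rho>)\<^sup>2) \<le> transient_complexity n dx dy dz hx hy hz" .
  have p2: "(1 - \<rho>) powr (-2) = 1 / (1 - \<rho>)\<^sup>2" using rho by (simp add: powr_minus_divide powr_numeral)
  \<comment> \<open>The base is below 1, so the smaller exponent gives the larger power;
    \<open>hx\<close> thereby obeys the same bound as the other terms.\<close>
  have "(1 - \<rho>) powr (- (3 / 2)) \<le> (1 - \<rho>) powr (-2)" using rho by (intro powr_mono') auto
  then have "K * (1 - \<rho>) powr (- (3 / 2)) \<le> K * (1 - \<rho>) powr (-2)" using K by (intro mult_left_mono) auto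
  with up(4) have hx: "hx \<le> K * (1 - \<rho>) powr (-2)" by linarith
  \<comment> \<open>As \<open>n\<close> is at least 1, lower powers of \<open>n\<close> are
    dominated by the cube.\<close>
  have bound: "real n ^ e * u \<le> K * (real n ^ 3 / (1 - \<rho>)\<^sup>2)"
    if "e \<le> 3" "u \<le> K * (1 - \<rho>) powr (-2)" for e u
  proof -
    have "real n ^ e * u \<le> real n ^ e * (K * (1 - \<rho>) powr (-2))" using that(2) by (intro mult_left_mono) auto
    also have "\<dots> \<le> real n ^ 3 * (K * (1 - \<rho>) powr (-2))"
      using that(1) n K by (intro mult_right_mono power_increasing) auto
    finally show ?thesis by (simp add: p2 mult.commute)
  qed
  show "transient_complexity n dx dy dz hx hy hz \<le> K * (real n ^ 3 / (1 - \<rho>)\<^sup>2)"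
    unfolding transient_complexity_def
    using bound[of 2, OF _ up(1)] bound[of 3, OF _ up(2)] bound[of 3, OF _ up(3)]
      bound[of 1, OF _ hx] bound[of 1, OF _ up(5)] bound[of 1, OF _ up(6)]
    by (intro Max.boundedI) auto
qed

text \<open>Choosing \<open>c\<close> and \<open>K\<close> before all other data makes the orders
  uniform in \<open>n\<close>, \<open>p\<close>, \<open>q\<close> and the matrices. Making the
  factors functions of \<open>M\<close> ensures that equal data receive equal
  factorizations.\<close>

theorem corollary2:
  fixes \<rho>0 :: real
  assumes "\<rho>0 > 0"
  shows "\<exists>c>0. \<exists>K>0. \<forall>(var :: variant) (n :: nat) (p :: nat) (q :: nat)
      (W :: block \<Rightarrow> real mat) (A :: block \<Rightarrow> real mat) (B :: block \<Rightarrow> real mat) (C :: block \<Rightarrow> real mat)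
      (U :: block \<Rightarrow> real mat) (La :: block \<Rightarrow> real mat) (Lb :: block \<Rightarrow> real mat) (Lc :: block \<Rightarrow> real mat).
    n \<ge> 2 \<and> p \<ge> 1 \<and> q \<ge> 1 \<and>
    (\<forall>s. mixing_matrix n \<rho>0 (W s)) \<and>
    (\<forall>s. sparkle_matrices var (W s) (A s) (B s) (C s)) \<and>
    (\<forall>s. spectral_data n (W s) (A s) (B s) (C s) (U s) (La s) (Lb s) (Lc s)) \<and>
    W BY = W BZ
    \<longrightarrow>
    (\<exists>(Qfac :: real mat \<Rightarrow> real mat) (Gfac :: real mat \<Rightarrow> real mat).
      let bLa = (\<lambda>s. bold (block_dim p q s) (La s));
          bLb = (\<lambda>s. bold (block_dim p q s) (Lb s));
          bLc = (\<lambda>s. bold (block_dim p q s) (Lc s));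
          M = (\<lambda>s. M_mat (bLb s) (bLc s));
          Q = (\<lambda>s. Qfac (M s));
          G = (\<lambda>s. Gfac (M s));
          dx = delta_x (Q BX) (G BX) (bLa BX);
          dy = delta_yz (Q BY) (G BY) (bLa BY);
          dz = delta_yz (Q BZ) (G BZ) (bLa BZ);
          hx = delta_hat_x (Q BX) (G BX) (bLb BX);
          hy = delta_hat_yz (Q BY) (G BY) (bLb BY);
          hz = delta_hat_yz (Q BZ) (G BZ) (bLb BZ)
      in (\<forall>s. factorization (M s) (Q s) (G s)) \<and>
         dx \<le> K * (1 - mix_rate (W BX)) powr (-2) \<and>
         dy = dz \<and> dy \<le> K * (1 - mix_rate (W BY)) powr (-2) \<and>
         hx \<le> K * (1 - mix_rate (W BX)) powr (- (3 / 2)) \<and>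
         hy = hz \<and> hy \<le> K * (1 - mix_rate (W BY)) powr (-2) \<and>
         (W BX = W BY \<longrightarrow>
            c * (real n ^ 3 / (1 - mix_rate (W BX))\<^sup>2) \<le> transient_complexity n dx dy dz hx hy hz \<and>
            transient_complexity n dx dy dz hx hy hz \<le> K * (real n ^ 3 / (1 - mix_rate (W BX))\<^sup>2)))"
proof -
  \<comment> \<open>\<open>K\<close> is the constant of \<open>sparkle_block_bounds\<close>; the
    witness for \<open>c\<close> is \<rho>0^2, from the lower bound \<rho>0 on the norm of
    \<open>La\<close>.\<close>
  define K where "K = 4 * (4 / \<rho>0)\<^sup>2"
  have K: "K > 0" using assms by (simp add: K_def)
  have c: "\<rho>0\<^sup>2 > 0" using assms by simp
  show ?thesis
  proof (rule exI[of _ "\<rho>0\<^sup>2"], rule conjI[OF c], rule exI[of _ K], rule conjI[OF K], intro allI impI,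
      elim conjE, rule exI[of _ Ofac_of], rule exI[of _ Gammafac_of])
    fix var :: variant and n p q :: nat
    fix W A B C U La Lb Lc :: "block \<Rightarrow> real mat"
    assume n: "n \<ge> 2" and p: "p \<ge> 1" and q: "q \<ge> 1"
      and mix: "\<forall>s. mixing_matrix n \<rho>0 (W s)"
      and sp: "\<forall>s. sparkle_matrices var (W s) (A s) (B s) (C s)"
      and sd: "\<forall>s. spectral_data n (W s) (A s) (B s) (C s) (U s) (La s) (Lb s) (Lc s)"
      and Wyz: "W BY = W BZ"
    have dim: "block_dim p q s \<ge> 1" for s using p q by (cases s) auto
    note spectrum = sparkle_spectrum[OF n assms mix[rule_format] sp[rule_format] sd[rule_format]]
    \<comment> \<open>\<open>U BY\<close> and \<open>U BZ\<close> may differ, but the diagonal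
      blocks are determined by \<open>W\<close> and the variant. Hence the matrices \<open>M\<close>
      agree, and with them the delta quantities for y and z.\<close>
    have yz: "La BY = La BZ" "Lb BY = Lb BZ" "Lc BY = Lc BZ"
      using spectrum(4-6)[of BY] spectrum(4-6)[of BZ] by (simp_all only: Wyz)
    note bounds = sparkle_block_bounds[OF n dim assms mix[rule_format] sp[rule_format] sd[rule_format],
        folded K_def]
    \<comment> \<open>In each instance one block argument selects the dimension and the other the
      matrices.\<close>
    note upper = bounds(2)[of BX BX] bounds(3)[of BY BY] bounds(3)[of BZ BZ]
      bounds(4)[of BX BX] bounds(5)[of BY BY] bounds(5)[of BZ BZ]
    have n1: "n \<ge> 1" using n by simp
    note order = transient_complexity_order[OF n1 K bounds(7)[of BX] bounds(8)[of BX]]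
    show "let bLa = (\<lambda>s. bold (block_dim p q s) (La s));
          bLb = (\<lambda>s. bold (block_dim p q s) (Lb s));
          bLc = (\<lambda>s. bold (block_dim p q s) (Lc s));
          M = (\<lambda>s. M_mat (bLb s) (bLc s));
          Q = (\<lambda>s. Ofac_of (M s));
          G = (\<lambda>s. Gammafac_of (M s));
          dx = delta_x (Q BX) (G BX) (bLa BX);
          dy = delta_yz (Q BY) (G BY) (bLa BY);
          dz = delta_yz (Q BZ) (G BZ) (bLa BZ);
          hx = delta_hat_x (Q BX) (G BX) (bLb BX);
          hy = delta_hat_yz (Q BY) (G BY) (bLb BY);
          hz = delta_hat_yz (Q BZ) (G BZ) (bLb BZ)
      in (\<forall>s. factorization (M s) (Q s) (G s)) \<and>
         dx \<le> K * (1 - mix_rate (W BX)) powr (-2) \<and>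
         dy = dz \<and> dy \<le> K * (1 - mix_rate (W BY)) powr (-2) \<and>
         hx \<le> K * (1 - mix_rate (W BX)) powr (- (3 / 2)) \<and>
         hy = hz \<and> hy \<le> K * (1 - mix_rate (W BY)) powr (-2) \<and>
         (W BX = W BY \<longrightarrow>
            \<rho>0\<^sup>2 * (real n ^ 3 / (1 - mix_rate (W BX))\<^sup>2) \<le> transient_complexity n dx dy dz hx hy hz \<and>
            transient_complexity n dx dy dz hx hy hz \<le> K * (real n ^ 3 / (1 - mix_rate (W BX))\<^sup>2))"
      unfolding Let_def
    proof (intro conjI impI allI, goal_cases)
      \<comment> \<open>Cases 8 and 9 are the two sides of the complexity estimate. Under
        \<open>W BX = W BY\<close> all rates become that of \<open>W BX\<close>.\<close>
      case 8
      then show ?case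
        using bounds(6)[of BY BY] upper Wyz by (intro order(1)) simp_all
    next
      case 9
      then show ?case
        using bounds(6)[of BY BY] upper Wyz by (intro order(2)) simp_all
    qed (rule bounds(1) upper | simp add: yz)+
  qed
qed

end
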